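(* Consider the eigenvalue problem $-u^{(6)}(x)=\lambda u(x)$ on $[0,1]$ with $u(0)=u'(0)=u''(0)=0$, $u(1)=u'(1)=u''(1)=0$. Its eigenvalues, in increasing order, are $\{\lambda_{n,3}\}_{n=2}^\infty=\{\mu_{n,3}^6\}_{n=2}^\infty$, where $\mu_{n,3}=n\pi$ if $n$ is even, and $\mu_{3,3}<\mu_{5,3}<\mu_{7,3}<\cdots$ are the positive solutions $\mu$ of the equation $$\cos\frac{\mu}{2}=\frac{4\cosh\frac{\mu\sqrt3}{2}}{\cosh(\mu\sqrt3)}+\frac{1}{\cosh(\mu\sqrt3)}\Big[\cos\frac{\mu}{2}\cos\mu-4\cos\frac{\mu}{2}\Big].$$ *)

theory Defs
  imports Complex_Main
begin

definition sixth_order_eigenvalue :: "real \<Rightarrow> bool" where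
  "sixth_order_eigenvalue lam \<longleftrightarrow>
     (\<exists>D :: nat \<Rightarrow> real \<Rightarrow> real.
        (\<forall>k<6. \<forall>x\<in>{0..1}. (D k has_real_derivative D (Suc k) x) (at x within {0..1}))
      \<and> continuous_on {0..1} (D 6)
      \<and> (\<forall>x\<in>{0..1}. - D 6 x = lam * D 0 x)
      \<and> (\<forall>k<3. D k 0 = 0 \<and> D k 1 = 0)
      \<and> (\<exists>x\<in>{0..1}. D 0 x \<noteq> 0))"

definition char_eq :: "real \<Rightarrow> bool" where
  "char_eq m \<longleftrightarrow>
     cos (m/2) = 4 * cosh (m * sqrt 3 / 2) / cosh (m * sqrt 3)
       + (1 / cosh (m * sqrt 3)) * (cos (m/2) * cos m - 4 * cos (m/2))"

end

theory Submission
  imports Defs "HOL-Analysis.Analysis"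
begin

text \<open>
  Centred at the midpoint, the solutions of \<open>-u\<^sup>(\<^sup>6\<^sup>) = m\<^sup>6 u\<close> split into a three-dimensional space of even
  functions and one of odd functions of \<open>t = m (x - 1/2)\<close>. The three conditions at the endpoint
  \<open>t = c = m/2\<close> admit a nonzero even solution iff \<open>sin c (cosh (\<surd>3 c) - cos c) = 0\<close>, and a nonzero odd
  solution iff \<open>cos c (cosh (\<surd>3 c) + cos c) = 2\<close>; the stated equation, cleared of denominators, is the latter times
  \<open>2 (cosh (\<surd>3 c) - cos c)\<close>. That there are no further eigenfunctions follows without solving the
  equation: pairing an eigenfunction with the explicit solutions through the constant bilinear
  concomitant forces its third to fifth derivatives at \<open>0\<close> to vanish when both determinants are
  nonzero. Monotonicity of \<open>cos c (cosh (\<surd>3 c) + cos c)\<close> where it takes values near \<open>2\<close> gives exactly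
  one root in each interval \<open>(k\<pi>, (k+1)\<pi>)\<close>, \<open>k \<ge> 1\<close>, and none in \<open>(0, \<pi>]\<close>, which is the interlacing.
\<close>

section \<open>Explicit even and odd solutions\<close>

text \<open>
  \<open>jet k p a b c\<close> is the \<open>k\<close>-th derivative of the general solution of \<open>-u\<^sup>(\<^sup>6\<^sup>) = u\<close> that is even
  (\<open>p\<close> true) or odd (\<open>p\<close> false); differentiation acts on the coefficients \<open>(b, c)\<close> as a rotation
  by \<open>\<pi>/6\<close>, the argument of the characteristic root \<open>\<surd>3/2 + i/2\<close>.
\<close>

primrec jet :: "nat \<Rightarrow> bool \<Rightarrow> real \<Rightarrow> real \<Rightarrow> real \<Rightarrow> real \<Rightarrow> real" where
  "jet 0 p a b c t =
     (if p then a * cos t + b * (cosh (sqrt 3 / 2 * t) * cos (t / 2))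
                + c * (sinh (sqrt 3 / 2 * t) * sin (t / 2))
      else a * sin t + b * (sinh (sqrt 3 / 2 * t) * cos (t / 2))
                + c * (cosh (sqrt 3 / 2 * t) * sin (t / 2)))"
| "jet (Suc k) p a b c t =
     jet k (\<not> p) (if p then - a else a)
       (sqrt 3 / 2 * b + c / 2) (sqrt 3 / 2 * c - b / 2) t"

lemma has_real_derivative_jet:
  "(jet k p a b c has_real_derivative jet (Suc k) p a b c t) (at t within S)"
proof (induction k arbitrary: p a b c)
  case 0
  have "jet 0 True a b c = (\<lambda>t. a * cos t + b * (cosh (sqrt 3 / 2 * t) * cos (t / 2))
      + c * (sinh (sqrt 3 / 2 * t) * sin (t / 2)))"
    "jet 0 False a b c = (\<lambda>t. a * sin t + b * (sinh (sqrt 3 / 2 * t) * cos (t / 2))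
      + c * (cosh (sqrt 3 / 2 * t) * sin (t / 2)))"
    by (rule ext, simp)+
  then show ?case
    by (cases p) (auto intro!: derivative_eq_intros simp: algebra_simps)
next
  case (Suc k)
  have "jet (Suc k) p a b c = jet k (\<not> p) (if p then - a else a)
       (sqrt 3 / 2 * b + c / 2) (sqrt 3 / 2 * c - b / 2)" by (rule ext) simp
  then show ?case
    using Suc[of "\<not> p" "if p then - a else a" "sqrt 3 / 2 * b + c / 2" "sqrt 3 / 2 * c - b / 2"]
    by (simp only: jet.simps(2)[of "Suc k" p])
qed

lemma sqrt3_square: "sqrt 3 * (sqrt 3 * x) = 3 * (x::real)"
  by (simp flip: mult.assoc)

text \<open>Six rotations by pi/6 make a half turn, and \<open>a\<close> changes sign at three of
  the six steps.\<close>

lemma jet_6: "jet 6 p a b c t = - jet 0 p a b c t"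
  by (cases p) (simp_all add: eval_nat_numeral field_simps sqrt3_square)

lemma jet_linear:
  "jet k p a b c t = a * jet k p 1 0 0 t + b * jet k p 0 1 0 t + c * jet k p 0 0 1 t"
proof (induction k arbitrary: p a b c)
  case 0
  show ?case by simp
next
  case (Suc k)
  show ?case
    unfolding jet.simps(2) Suc[of "\<not> p" "if p then - a else a"]
      Suc[of "\<not> p" "if p then - 1 else 1"] Suc[of "\<not> p" "if p then - 0 else 0"]
    by (simp add: algebra_simps)
qed

lemma jet_minus:
  "jet k p a b c (- t) = (if even k = p then 1 else - 1) * jet k p a b c t"
proof (induction k arbitrary: p a b c)
  case 0
  show ?case by simp
next
  case (Suc k)
  show ?case unfolding jet.simps(2) Suc by simp
qed

section \<open>Boundary determinants\<close>

text \<open>This is the Wronskian matrix of the three basis solutions of parity \<open>p\<close>. By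
  parity, three vanishing conditions at \<open>m / 2\<close> also give those at the other
  endpoint.\<close>

definition jet_matrix :: "bool \<Rightarrow> real \<Rightarrow> real^3^3" where
  "jet_matrix p t = (\<chi> i j. jet (if i = 1 then 0 else if i = 2 then 1 else 2) p
     (if j = 1 then 1 else 0) (if j = 2 then 1 else 0) (if j = 3 then 1 else 0) t)"

lemma jet_matrix_mult:
  "(jet_matrix p t *v x) $ 1 = jet 0 p (x $ 1) (x $ 2) (x $ 3) t"
  "(jet_matrix p t *v x) $ 2 = jet 1 p (x $ 1) (x $ 2) (x $ 3) t"
  "(jet_matrix p t *v x) $ 3 = jet 2 p (x $ 1) (x $ 2) (x $ 3) t"
  by (simp_all only: jet_linear[of _ p "x $ 1"])
     (simp_all add: jet_matrix_def matrix_vector_mult_def sum_3 algebra_simps)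

lemma jet_prescribed:
  assumes "det (jet_matrix p t) \<noteq> 0"
  obtains a b c where "jet 0 p a b c t = y0" "jet 1 p a b c t = y1" "jet 2 p a b c t = y2"
proof -
  have "invertible (jet_matrix p t)"
    using assms by (simp add: invertible_det_nz)
  then obtain B where "jet_matrix p t ** B = mat 1"
    by (auto simp: invertible_def)
  then have "jet_matrix p t *v (B *v vector [y0, y1, y2]) = vector [y0, y1, y2]"
    by (simp add: matrix_vector_mul_assoc)
  then show thesis
    using that jet_matrix_mult[of p t "B *v vector [y0, y1, y2]"] by (metis vector_3)
qed

lemma jet_kernel:
  assumes "det (jet_matrix p t) = 0"
  obtains a b c where "(a, b, c) \<noteq> (0, 0, 0)" "\<forall>k<3. jet k p a b c t = 0"
proof -
  have "\<not> invertible (jet_matrix p t)"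
    using assms by (simp add: invertible_det_nz)
  then obtain x where x: "x \<noteq> 0" "jet_matrix p t *v x = 0"
    by (metis invertible_left_inverse matrix_left_invertible_ker)
  have "(x $ 1, x $ 2, x $ 3) \<noteq> (0, 0, 0)"
    using x(1) by (auto simp: vec_eq_iff forall_3)
  moreover have "\<forall>k<3. jet k p (x $ 1) (x $ 2) (x $ 3) t = 0"
    using jet_matrix_mult[of p t x] x(2)
    by (auto simp: less_Suc_eq eval_nat_numeral simp del: jet.simps)
  ultimately show thesis using that by blast
qed

lemma jet_matrix_entries:
  "jet_matrix p t $ 1 $ 1 = jet 0 p 1 0 0 t" "jet_matrix p t $ 1 $ 2 = jet 0 p 0 1 0 t"
  "jet_matrix p t $ 1 $ 3 = jet 0 p 0 0 1 t" "jet_matrix p t $ 2 $ 1 = jet 1 p 1 0 0 t"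
  "jet_matrix p t $ 2 $ 2 = jet 1 p 0 1 0 t" "jet_matrix p t $ 2 $ 3 = jet 1 p 0 0 1 t"
  "jet_matrix p t $ 3 $ 1 = jet 2 p 1 0 0 t" "jet_matrix p t $ 3 $ 2 = jet 2 p 0 1 0 t"
  "jet_matrix p t $ 3 $ 3 = jet 2 p 0 0 1 t"
  by (simp_all add: jet_matrix_def)

lemma half_angle_real:
  fixes t :: real
  defines "A \<equiv> sqrt 3 / 2 * t" and "B \<equiv> t / 2"
  shows "cosh A ^ 2 = (cosh (sqrt 3 * t) + 1) / 2" "sinh A ^ 2 = (cosh (sqrt 3 * t) - 1) / 2"
    "cos B ^ 2 = (1 + cos t) / 2" "sin B ^ 2 = (1 - cos t) / 2" "sin B * cos B = sin t / 2"
proof -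
  have A: "sqrt 3 * t = 2 * A" and B: "t = 2 * B" by (simp_all add: A_def B_def)
  show "cosh A ^ 2 = (cosh (sqrt 3 * t) + 1) / 2" "sinh A ^ 2 = (cosh (sqrt 3 * t) - 1) / 2"
    unfolding A cosh_double using cosh_square_eq[of A] by (simp_all add: field_simps)
  have "cos t = 2 * cos B ^ 2 - 1" "sin t = 2 * (sin B * cos B)"
    unfolding B cos_double_cos sin_double by simp_all
  then show "cos B ^ 2 = (1 + cos t) / 2" "sin B ^ 2 = (1 - cos t) / 2" "sin B * cos B = sin t / 2"
    using sin_cos_squared_add[of B] by algebra+
qed

text \<open>The last two columns are combinations of the four products \<open>P\<close>,
  \<open>Q\<close>, \<open>R\<close>, \<open>T\<close>. The mixed terms cancel, so they enter only
  through \<open>R * Q - T * P\<close> and \<open>P ^ 2 + Q ^ 2\<close>, which the half-angle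
  formulas turn into functions of \<open>t\<close> and \<open>sqrt 3 * t\<close>.\<close>

lemma det_jet_matrix_even:
  "det (jet_matrix True t) = sqrt 3 / 4 * (sin t * (cosh (sqrt 3 * t) - cos t))"
proof -
  define P Q R T where
    "P = cosh (sqrt 3 / 2 * t) * cos (t / 2)" and "Q = sinh (sqrt 3 / 2 * t) * sin (t / 2)" and
    "R = sinh (sqrt 3 / 2 * t) * cos (t / 2)" and "T = cosh (sqrt 3 / 2 * t) * sin (t / 2)"
  have j: "jet 0 True a b c t = a * cos t + b * P + c * Q"
    "jet 0 False a b c t = a * sin t + b * R + c * T" for a b c
    by (simp_all add: P_def Q_def R_def T_def)
  note h = half_angle_real[of t]
  have "R * Q - T * P = (sinh (sqrt 3 / 2 * t) ^ 2 - cosh (sqrt 3 / 2 * t) ^ 2) * (sin (t / 2) * cos (t / 2))"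
    by (simp add: P_def Q_def R_def T_def power2_eq_square algebra_simps)
  then have 1: "R * Q - T * P = - sin t / 2" unfolding h by (simp add: field_simps)
  have "P ^ 2 + Q ^ 2 = (cosh (sqrt 3 * t) + cos t) / 2"
    unfolding P_def Q_def power_mult_distrib h by (simp add: field_simps)
  note 2 = this
  have "det (jet_matrix True t) = sqrt 3 * (cos t * (R * Q - T * P) + sin t / 2 * (P ^ 2 + Q ^ 2))"
    unfolding det_3 jet_matrix_entries
    by (simp add: eval_nat_numeral j del: jet.simps(1)) (simp add: field_simps sqrt3_square)
  then show ?thesis unfolding 1 2 by (simp add: field_simps)
qed

lemma det_jet_matrix_odd:
  "det (jet_matrix False t) = sqrt 3 / 4 * (2 - cos t * (cosh (sqrt 3 * t) + cos t))"
proof -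
  define P Q R T where
    "P = cosh (sqrt 3 / 2 * t) * cos (t / 2)" and "Q = sinh (sqrt 3 / 2 * t) * sin (t / 2)" and
    "R = sinh (sqrt 3 / 2 * t) * cos (t / 2)" and "T = cosh (sqrt 3 / 2 * t) * sin (t / 2)"
  have j: "jet 0 True a b c t = a * cos t + b * P + c * Q"
    "jet 0 False a b c t = a * sin t + b * R + c * T" for a b c
    by (simp_all add: P_def Q_def R_def T_def)
  note h = half_angle_real[of t]
  have "P * T - Q * R = (cosh (sqrt 3 / 2 * t) ^ 2 - sinh (sqrt 3 / 2 * t) ^ 2) * (sin (t / 2) * cos (t / 2))"
    by (simp add: P_def Q_def R_def T_def power2_eq_square algebra_simps)
  then have 1: "P * T - Q * R = sin t / 2" unfolding h by (simp add: field_simps)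
  have "R ^ 2 + T ^ 2 = (cosh (sqrt 3 * t) - cos t) / 2"
    unfolding R_def T_def power_mult_distrib h by (simp add: field_simps)
  note 2 = this
  have "det (jet_matrix False t) = sqrt 3 * (sin t * (P * T - Q * R) - cos t / 2 * (R ^ 2 + T ^ 2))"
    unfolding det_3 jet_matrix_entries
    by (simp add: eval_nat_numeral j del: jet.simps(1)) (simp add: field_simps sqrt3_square)
  also have "\<dots> = sqrt 3 / 4 * (2 * sin t ^ 2 - cos t * (cosh (sqrt 3 * t) - cos t))"
    unfolding 1 2 by (simp add: field_simps power2_eq_square)
  also have "\<dots> = sqrt 3 / 4 * (2 - cos t * (cosh (sqrt 3 * t) + cos t))"
    unfolding sin_squared_eq by (simp add: field_simps power2_eq_square)
  finally show ?thesis .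
qed

section \<open>Uniqueness and the Lagrange identity\<close>

definition solution_jet :: "real \<Rightarrow> (nat \<Rightarrow> real \<Rightarrow> real) \<Rightarrow> bool" where
  "solution_jet lam D \<longleftrightarrow>
     (\<forall>k<6. \<forall>x\<in>{0..1}. (D k has_real_derivative D (Suc k) x) (at x within {0..1}))
     \<and> (\<forall>x\<in>{0..1}. D 6 x = - lam * D 0 x)"

lemma solution_jet_derivs:
  assumes "solution_jet lam D" "x \<in> {0..1}"
  shows "(D 0 has_real_derivative D 1 x) (at x within {0..1})"
    "(D 1 has_real_derivative D 2 x) (at x within {0..1})"
    "(D 2 has_real_derivative D 3 x) (at x within {0..1})"
    "(D 3 has_real_derivative D 4 x) (at x within {0..1})"
    "(D 4 has_real_derivative D 5 x) (at x within {0..1})"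
    "(D 5 has_real_derivative - lam * D 0 x) (at x within {0..1})"
proof -
  have "(D k has_real_derivative D (Suc k) x) (at x within {0..1})" if "k < 6" for k
    using assms that by (auto simp: solution_jet_def)
  from this[of 0] this[of 1] this[of 2] this[of 3] this[of 4] this[of 5]
  show "(D 0 has_real_derivative D 1 x) (at x within {0..1})"
    "(D 1 has_real_derivative D 2 x) (at x within {0..1})"
    "(D 2 has_real_derivative D 3 x) (at x within {0..1})"
    "(D 3 has_real_derivative D 4 x) (at x within {0..1})"
    "(D 4 has_real_derivative D 5 x) (at x within {0..1})"
    "(D 5 has_real_derivative - lam * D 0 x) (at x within {0..1})"
    using assms by (simp_all add: eval_nat_numeral solution_jet_def)
qed

lemma sixth_order_eigenvalue_iff:
  "sixth_order_eigenvalue lam \<longleftrightarrow>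
     (\<exists>D. solution_jet lam D \<and> (\<forall>k<3. D k 0 = 0 \<and> D k 1 = 0) \<and> (\<exists>x\<in>{0..1}. D 0 x \<noteq> 0))"
proof
  assume "sixth_order_eigenvalue lam"
  then obtain D where
    "\<forall>k<6. \<forall>x\<in>{0..1}. (D k has_real_derivative D (Suc k) x) (at x within {0..1})"
    and *: "\<forall>x\<in>{0..1}. - D 6 x = lam * D 0 x"
    and "\<forall>k<3. D k 0 = 0 \<and> D k 1 = 0" "\<exists>x\<in>{0..1}. D 0 x \<noteq> 0"
    unfolding sixth_order_eigenvalue_def by blast
  moreover have "\<forall>x\<in>{0..1}. D 6 x = - lam * D 0 x"
  proof
    fix x :: real
    assume "x \<in> {0..1}"
    then have "- D 6 x = lam * D 0 x" using * by blast
    then show "D 6 x = - lam * D 0 x" by linarith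
  qed
  ultimately show "\<exists>D. solution_jet lam D \<and> (\<forall>k<3. D k 0 = 0 \<and> D k 1 = 0) \<and> (\<exists>x\<in>{0..1}. D 0 x \<noteq> 0)"
    unfolding solution_jet_def by blast
next
  assume "\<exists>D. solution_jet lam D \<and> (\<forall>k<3. D k 0 = 0 \<and> D k 1 = 0) \<and> (\<exists>x\<in>{0..1}. D 0 x \<noteq> 0)"
  then obtain D where D: "solution_jet lam D" "\<forall>k<3. D k 0 = 0 \<and> D k 1 = 0"
    "\<exists>x\<in>{0..1}. D 0 x \<noteq> 0" by blast
  \<comment> \<open>The equation reduces continuity of \<open>D 6\<close> to that of the
    differentiable function \<open>D 0\<close>.\<close>
  have "continuous_on {0..1} (D 0)"
    using solution_jet_derivs(1)[OF D(1)] by (rule DERIV_continuous_on)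
  then have "continuous_on {0..1} (\<lambda>x. - lam * D 0 x)" by (intro continuous_intros)
  then have "continuous_on {0..1} (D 6)"
    using D(1) by (subst continuous_on_cong[OF refl]) (auto simp: solution_jet_def)
  then show "sixth_order_eigenvalue lam"
    unfolding sixth_order_eigenvalue_def using D by (intro exI[of _ D]) (auto simp: solution_jet_def)
qed

lemma solution_jet_jet:
  "solution_jet (m ^ 6) (\<lambda>k x. m ^ k * jet k p a b c (m * (x - 1 / 2)))"
proof -
  have "((\<lambda>x. m ^ k * jet k p a b c (m * (x - 1 / 2))) has_real_derivative
          m ^ Suc k * jet (Suc k) p a b c (m * (x - 1 / 2))) (at x within {0..1})" for k x
    by (rule derivative_eq_intros refl
          DERIV_chain2[where f = "jet k p a b c", OF has_real_derivative_jet])+ simp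
  then show ?thesis
    by (auto simp: solution_jet_def jet_6 simp del: jet.simps)
qed

lemma has_real_derivative_at_interior:
  assumes "\<And>x. x \<in> {0..1} \<Longrightarrow> (f has_real_derivative f' x) (at x within {0..1})" "0 < x" "x < 1"
  shows "(f has_real_derivative f' x) (at x)"
  using assms(1)[of x] assms(2,3) at_within_Icc_at[of 0 x 1] by simp

lemma nonneg_derivative_mono:
  assumes "\<And>x. x \<in> {0..1} \<Longrightarrow> (f has_real_derivative f' x) (at x within {0..1})"
    "\<And>x. x \<in> {0..1} \<Longrightarrow> 0 \<le> f' x" "0 \<le> x" "x \<le> y" "y \<le> 1"
  shows "f x \<le> (f y :: real)"
proof (rule DERIV_nonneg_imp_increasing_open[of x y f])
  show "x \<le> y" by fact
  show "\<exists>z. (f has_real_derivative z) (at t) \<and> 0 \<le> z" if "x < t" "t < y" for t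
  proof -
    have "(f has_real_derivative f' t) (at t)"
      by (rule has_real_derivative_at_interior[OF assms(1)]) (use assms(3-5) that in auto)
    moreover have "0 \<le> f' t" using assms(2)[of t] assms(3-5) that by simp
    ultimately show ?thesis by blast
  qed
  have "continuous_on {0..1} f" using assms(1) by (rule DERIV_continuous_on)
  then show "continuous_on {x..y} f"
    by (rule continuous_on_subset) (use assms in auto)
qed

text \<open>A Gronwall argument: \<open>E' x \<le> K * E x\<close>, so
  \<open>E x * exp (- K * x)\<close> is nonincreasing, starts at 0 and is nonnegative.\<close>

lemma solution_jet_unique:
  assumes D: "solution_jet lam D" and init: "\<forall>k<6. D k 0 = 0" and x: "x \<in> {0..1}"
  shows "D 0 x = 0"
proof -
  define E where "E x = D 0 x ^ 2 + D 1 x ^ 2 + D 2 x ^ 2 + D 3 x ^ 2 + D 4 x ^ 2 + D 5 x ^ 2" for x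
  define E' where "E' x = 2 * (D 0 x * D 1 x + D 1 x * D 2 x + D 2 x * D 3 x + D 3 x * D 4 x
    + D 4 x * D 5 x - lam * (D 0 x * D 5 x))" for x
  \<comment> \<open>Applying 2uv \<le> u^2 + v^2 to each product in \<open>E'\<close> costs at most
    two copies of every square, and \<open>lam ^ 2\<close> more for \<open>D 0\<close>.\<close>
  define K where "K = 2 + lam ^ 2"
  define F where "F x = - (E x * exp (- K * x))" for x
  have dE: "(E has_real_derivative E' x) (at x within {0..1})" if "x \<in> {0..1}" for x
    unfolding E_def E'_def
    by (rule derivative_eq_intros solution_jet_derivs[OF D that] refl)+ (simp add: algebra_simps)
  have dF: "(F has_real_derivative (K * E x - E' x) * exp (- K * x)) (at x within {0..1})"
    if "x \<in> {0..1}" for x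
    unfolding F_def
    by (rule derivative_eq_intros dE[OF that] refl)+ (simp add: algebra_simps)
  have "E' x \<le> K * E x" for x
  proof -
    have am: "2 * (u * v) \<le> u ^ 2 + v ^ 2" for u v :: real
      using sum_squares_bound[of u v] by (simp add: mult.assoc)
    define L where "L = lam ^ 2 * E x"
    have "- (2 * (lam * (D 0 x * D 5 x))) \<le> lam ^ 2 * D 0 x ^ 2 + D 5 x ^ 2"
      using am[of "- (lam * D 0 x)" "D 5 x"] by (simp add: power_mult_distrib mult.assoc)
    moreover have "lam ^ 2 * D 0 x ^ 2 \<le> L"
      unfolding E_def L_def by (intro mult_left_mono) auto
    moreover have "K * E x = 2 * E x + L" by (simp add: K_def L_def distrib_right)
    moreover have "E x = D 0 x ^ 2 + D 1 x ^ 2 + D 2 x ^ 2 + D 3 x ^ 2 + D 4 x ^ 2 + D 5 x ^ 2"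
      by (simp add: E_def)
    moreover have "0 \<le> D 0 x ^ 2" by simp
    ultimately show ?thesis
      unfolding E'_def
      using am[of "D 0 x" "D 1 x"] am[of "D 1 x" "D 2 x"] am[of "D 2 x" "D 3 x"]
        am[of "D 3 x" "D 4 x"] am[of "D 4 x" "D 5 x"]
      by argo
  qed
  then have "F 0 \<le> F x"
    using x by (intro nonneg_derivative_mono[OF dF]) auto
  moreover have "E 0 = 0" using init by (simp add: E_def)
  ultimately have "E x * exp (- K * x) \<le> 0" by (simp add: F_def)
  then have "E x \<le> 0" by (simp add: mult_le_0_iff not_le[symmetric])
  then have "D 0 x ^ 2 \<le> 0"
    unfolding E_def by (smt (verit) zero_le_power2)
  then show ?thesis by simp
qed

text \<open>The boundary term of Lagrange's identity: for derivative families its derivative is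
  \<open>u 0 x * v 6 x - u 6 x * v 0 x\<close>, which vanishes when both solve the equation with the
  same \<open>lam\<close>.\<close>

definition bilinear_concomitant ::
  "(nat \<Rightarrow> real \<Rightarrow> real) \<Rightarrow> (nat \<Rightarrow> real \<Rightarrow> real) \<Rightarrow> real \<Rightarrow> real" where
  "bilinear_concomitant u v x = u 0 x * v 5 x - u 1 x * v 4 x + u 2 x * v 3 x
     - u 3 x * v 2 x + u 4 x * v 1 x - u 5 x * v 0 x"

lemma bilinear_concomitant_const:
  assumes u: "solution_jet lam u" and v: "solution_jet lam v"
  shows "bilinear_concomitant u v 0 = bilinear_concomitant u v 1"
proof -
  have "(bilinear_concomitant u v has_real_derivative 0) (at x within {0..1})"
    if "x \<in> {0..1}" for x
    unfolding bilinear_concomitant_def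
    by (rule derivative_eq_intros solution_jet_derivs[OF u that] solution_jet_derivs[OF v that] refl)+
       (simp add: algebra_simps)
  then show ?thesis
    using has_field_derivative_zero_constant[of "{0..1}" "bilinear_concomitant u v"] by force
qed

section \<open>Positivity of the eigenvalues\<close>

lemma eigenvalue_pos:
  assumes "sixth_order_eigenvalue lam"
  shows "lam > 0"
proof (rule ccontr)
  assume lam: "\<not> lam > 0"
  obtain D where D: "solution_jet lam D" and bc: "\<forall>k<3. D k 0 = 0 \<and> D k 1 = 0"
    and nz: "\<exists>x\<in>{0..1}. D 0 x \<noteq> 0"
    using assms unfolding sixth_order_eigenvalue_iff by blast
  note d = solution_jet_derivs[OF D]
  \<comment> \<open>Integration by parts of \<open>\<integral> u u\<^sup>(\<^sup>6\<^sup>)\<close>, in differential form.\<close>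
  define W where "W x = D 0 x * D 5 x - D 1 x * D 4 x + D 2 x * D 3 x" for x
  have dW: "(W has_real_derivative D 3 x ^ 2 - lam * D 0 x ^ 2) (at x within {0..1})"
    if "x \<in> {0..1}" for x
    unfolding W_def
    by (rule derivative_eq_intros d[OF that] refl)+ (simp add: algebra_simps power2_eq_square)
  have nn: "0 \<le> D 3 x ^ 2 - lam * D 0 x ^ 2" for x
    using lam by (smt (verit) mult_nonneg_nonneg zero_le_power2 mult_minus_left)
  have W01: "W 0 = 0" "W 1 = 0" using bc by (simp_all add: W_def)
  \<comment> \<open>\<open>W\<close> is nondecreasing and vanishes at both ends, hence everywhere.
    Its derivative is a sum of two nonnegative terms, since \<open>lam\<close> is not positive, so
    \<open>D 3\<close> vanishes too.\<close>
  have W0: "W x = 0" if "x \<in> {0..1}" for x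
    using nonneg_derivative_mono[OF dW nn, of 0 x] nonneg_derivative_mono[OF dW nn, of x 1] that W01
    by simp
  have D3: "D 3 x = 0" if "0 < x" "x < 1" for x
  proof -
    have "(W has_real_derivative D 3 x ^ 2 - lam * D 0 x ^ 2) (at x)"
      using has_real_derivative_at_interior[OF dW] that by simp
    moreover have "(W has_real_derivative 0) (at x)"
      by (rule has_field_derivative_transform_within_open[of "\<lambda>_. 0" _ _ "{0<..<1}"])
         (use that W0 in auto)
    ultimately have "D 3 x ^ 2 - lam * D 0 x ^ 2 = 0" by (rule DERIV_unique)
    moreover have "- lam * D 0 x ^ 2 \<ge> 0" using lam by (intro mult_nonneg_nonneg) auto
    ultimately have "D 3 x ^ 2 \<le> 0" by simp
    then show ?thesis by simp
  qed
  \<comment> \<open>\<open>D 3\<close> is known to vanish only in the open interval, so the descent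
    to \<open>D 0\<close> uses interior derivatives and the value at 0.\<close>
  have zero: "f x = 0" if "\<And>x. x \<in> {0..1} \<Longrightarrow> (f has_real_derivative f' x) (at x within {0..1})"
    "\<And>x. \<lbrakk>0 < x; x < 1\<rbrakk> \<Longrightarrow> f' x = 0" "f 0 = 0" "x \<in> {0..1}" for f f' :: "real \<Rightarrow> real" and x
  proof (cases "x = 0")
    case False
    have "continuous_on {0..1} f" using that(1) by (rule DERIV_continuous_on)
    then have "continuous_on {0..x} f"
      by (rule continuous_on_subset) (use that(4) in auto)
    moreover have "(f has_real_derivative 0) (at t)" if "0 < t" "t < x" for t
      using has_real_derivative_at_interior[of f f' t] \<open>\<And>x. \<lbrakk>0 < x; x < 1\<rbrakk> \<Longrightarrow> f' x = 0\<close>[of t]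
        \<open>\<And>x. x \<in> {0..1} \<Longrightarrow> (f has_real_derivative f' x) (at x within {0..1})\<close> that \<open>x \<in> {0..1}\<close>
      by simp
    ultimately have "f x = f 0"
      using False that(4) by (intro DERIV_isconst_end) auto
    then show ?thesis using that(3) by simp
  qed (use that in simp)
  have "D 2 x = 0" if "x \<in> {0..1}" for x
    using zero[OF d(3) D3 _ that] bc by simp
  then have "D 1 x = 0" if "x \<in> {0..1}" for x
    using zero[OF d(2) _ _ that] bc by simp
  then have "D 0 x = 0" if "x \<in> {0..1}" for x
    using zero[OF d(1) _ _ that] bc by simp
  with nz show False by blast
qed

section \<open>Eigenvalues as zeros of the determinants\<close>

text \<open>These are the endpoint relations of a function whose parity about the midpoint is
  opposite to \<open>p\<close>: a nonzero determinant rules out a component of parity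
  \<open>p\<close>. Both parities together force the three derivatives at 0 to vanish.\<close>

lemma eigenfunction_parity:
  assumes D: "solution_jet (m ^ 6) D" and bc: "\<forall>k<3. D k 0 = 0 \<and> D k 1 = 0"
    and m: "m > 0" and det: "det (jet_matrix p (m / 2)) \<noteq> 0"
  defines "s \<equiv> if p then 1 else - 1"
  shows "D 3 1 = s * D 3 0" "D 4 1 = - s * D 4 0" "D 5 1 = s * D 5 0"
proof -
  \<comment> \<open>The boundary values are chosen so that the concomitant identity becomes a vanishing sum of squares.\<close>
  obtain a b c where abc: "jet 0 p a b c (m / 2) = - (D 5 1 - s * D 5 0)"
    "jet 1 p a b c (m / 2) = (D 4 1 + s * D 4 0) / m"
    "jet 2 p a b c (m / 2) = - (D 3 1 - s * D 3 0) / m ^ 2"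
    using jet_prescribed[OF det] by metis
  define v where "v = (\<lambda>k x. m ^ k * jet k p a b c (m * (x - 1 / 2)))"
  have v: "solution_jet (m ^ 6) v" unfolding v_def by (rule solution_jet_jet)
  have v1: "v 0 1 = - (D 5 1 - s * D 5 0)" "v 1 1 = D 4 1 + s * D 4 0"
    "v 2 1 = - (D 3 1 - s * D 3 0)"
    using abc m unfolding v_def by (simp_all del: jet.simps)
  have v0: "v k 0 = s * (- 1) ^ k * v k 1" for k
    using jet_minus[of k p a b c "m / 2"] unfolding v_def s_def by (simp del: jet.simps)
  have "bilinear_concomitant D v 0 = bilinear_concomitant D v 1"
    using D v by (rule bilinear_concomitant_const)
  then have "(D 3 1 - s * D 3 0) ^ 2 + (D 4 1 + s * D 4 0) ^ 2 + (D 5 1 - s * D 5 0) ^ 2 = 0"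
    using bc unfolding bilinear_concomitant_def v0[of 0] v0[of 1] v0[of 2] v1
    by (simp add: algebra_simps power2_eq_square)
  then have "(D 3 1 - s * D 3 0) = 0 \<and> (D 4 1 + s * D 4 0) = 0 \<and> (D 5 1 - s * D 5 0) = 0"
    by (smt (verit) power2_eq_iff zero_le_power2 zero_eq_power2)
  then show "D 3 1 = s * D 3 0" "D 4 1 = - s * D 4 0" "D 5 1 = s * D 5 0" by simp_all
qed

text \<open>Linear independence of the basis solutions, which makes a nonzero kernel vector of the
  matrix a genuine eigenfunction.\<close>

lemma jet_nontrivial:
  assumes m: "m > 0" and z: "\<forall>x\<in>{0..1}. jet 0 p a b c (m * (x - 1 / 2)) = 0"
  shows "(a, b, c) = (0, 0, 0)"
proof -
  define r where "r = m / 2"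
  have "jet k p a b c t = 0" if "\<bar>t\<bar> < r" for k t
    using that
  proof (induction k arbitrary: t)
    case 0
    define x where "x = t / m + 1 / 2"
    have "x \<in> {0..1}" using 0 m by (auto simp: x_def r_def field_simps abs_less_iff)
    moreover have "m * (x - 1 / 2) = t" using m by (simp add: x_def)
    ultimately show ?case using z by metis
  next
    case (Suc k)
    have "(jet k p a b c has_real_derivative 0) (at t)"
      by (rule has_field_derivative_transform_within_open[of "\<lambda>_. 0" _ _ "{-r<..<r}"])
         (use Suc in \<open>auto simp: abs_less_iff\<close>)
    then show ?case using has_real_derivative_jet DERIV_unique by blast
  qed
  then have z: "jet k p a b c 0 = 0" for k using m by (simp add: r_def del: jet.simps)
  have "a = 0 \<and> b = 0 \<and> sqrt 3 * c = 0"
  \<comment> \<open>At 0 only derivatives of even order carry information for an even solution, and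
    only those of odd order for an odd one.\<close>
  proof (cases p)
    case True
    have "a + b = 0" "- a + b / 2 + sqrt 3 * c / 2 = 0" "a - b / 2 + sqrt 3 * c / 2 = 0"
      using z[of 0] z[of 2] z[of 4] True
      by (simp_all add: eval_nat_numeral field_simps sqrt3_square)
    then show ?thesis by linarith
  next
    case False
    have "2 * a + sqrt 3 * b + c = 0" "c = a" "2 * a - sqrt 3 * b + c = 0"
      using z[of 1] z[of 3] z[of 5] False
      by (simp_all add: eval_nat_numeral field_simps sqrt3_square)
    then have "a = 0" "c = 0" "sqrt 3 * b = 0" by linarith+
    then show ?thesis by simp
  qed
  then show ?thesis by simp
qed

lemma eigenvalue_iff_det:
  assumes m: "m > 0"
  shows "sixth_order_eigenvalue (m ^ 6) \<longleftrightarrow> (\<exists>p. det (jet_matrix p (m / 2)) = 0)"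
proof
  assume "sixth_order_eigenvalue (m ^ 6)"
  then obtain D where D: "solution_jet (m ^ 6) D" and bc: "\<forall>k<3. D k 0 = 0 \<and> D k 1 = 0"
    and nz: "\<exists>x\<in>{0..1}. D 0 x \<noteq> 0"
    unfolding sixth_order_eigenvalue_iff by blast
  show "\<exists>p. det (jet_matrix p (m / 2)) = 0"
  proof (rule ccontr)
    assume "\<not> ?thesis"
    then have det: "det (jet_matrix p (m / 2)) \<noteq> 0" for p by blast
    have "D 3 0 = 0" "D 4 0 = 0" "D 5 0 = 0"
      using eigenfunction_parity[OF D bc m det[of True]] eigenfunction_parity[OF D bc m det[of False]]
      by simp_all
    then have "\<forall>k<6. D k 0 = 0" using bc by (auto simp: less_Suc_eq eval_nat_numeral)
    then show False using solution_jet_unique[OF D] nz by blast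
  qed
next
  assume "\<exists>p. det (jet_matrix p (m / 2)) = 0"
  then obtain p a b c where abc: "(a, b, c) \<noteq> (0, 0, 0)" "\<forall>k<3. jet k p a b c (m / 2) = 0"
    using jet_kernel by metis
  define v where "v = (\<lambda>k x. m ^ k * jet k p a b c (m * (x - 1 / 2)))"
  have "\<forall>k<3. v k 0 = 0 \<and> v k 1 = 0"
    using abc(2) jet_minus[of _ p a b c "m / 2"] unfolding v_def by (simp del: jet.simps)
  moreover have "\<exists>x\<in>{0..1}. v 0 x \<noteq> 0"
    using jet_nontrivial[OF m] abc(1) m unfolding v_def by (metis mult_1 power_0)
  moreover have "solution_jet (m ^ 6) v" unfolding v_def by (rule solution_jet_jet)
  ultimately show "sixth_order_eigenvalue (m ^ 6)" unfolding sixth_order_eigenvalue_iff by blast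
qed

section \<open>Roots of the odd characteristic function\<close>

text \<open>By \<open>det_jet_matrix_odd\<close>, the odd determinant at \<open>c\<close> vanishes
  exactly where this takes the value 2.\<close>

definition odd_char :: "real \<Rightarrow> real" where
  "odd_char c = cos c * (cosh (sqrt 3 * c) + cos c)"

lemma cosh_sqrt3_gt_1: "c > 0 \<Longrightarrow> cosh (sqrt 3 * c) > (1::real)"
  using cosh_real_strict_mono[of 0 "sqrt 3 * c"] by simp

lemma cosh_plus_cos_nonneg: "0 \<le> cosh (y::real) + cos c"
  using cosh_real_ge_1[of y] cos_ge_minus_one[of c] by linarith

lemma odd_char_nonpos: "cos c \<le> 0 \<Longrightarrow> odd_char c \<le> 0"
  unfolding odd_char_def using cosh_plus_cos_nonneg by (intro mult_nonpos_nonneg) auto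

lemma cos_shift: "cos (2 * real j * pi + t) = cos t" "sin (2 * real j * pi + t) = sin t"
  by (simp_all add: cos_add sin_add)

text \<open>Seen as an even solution plus a constant, the function has Taylor coefficients that
  \<open>jet\<close> computes.\<close>

lemma odd_char_eq_jet: "odd_char c = 1 / 2 + jet 0 True (1 / 2) 1 0 (2 * c)"
  using cos_double_cos[of c] by (simp add: odd_char_def algebra_simps power2_eq_square)

text \<open>
  All Taylor coefficients of order 1 to 5 at \<open>0\<close> of the jet above vanish, and its sixth derivative is
  its negative.
\<close>

lemma odd_char_less_2_near_0:
  assumes "0 < c" "c \<le> pi / 3"
  shows "odd_char c < 2"
proof -
  let ?f = "\<lambda>k. jet k True (1 / 2) 1 0"
  have "\<exists>t. 0 < t \<and> t < 2 * c \<and>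
      ?f 0 (2 * c) = (\<Sum>k<6. ?f k 0 / fact k * (2 * c) ^ k) + ?f 6 t / fact 6 * (2 * c) ^ 6"
    by (rule Maclaurin) (use assms in \<open>auto intro: has_real_derivative_jet simp del: jet.simps\<close>)
  then obtain t where t: "0 < t" "t < 2 * c" and
    eq: "?f 0 (2 * c) = (\<Sum>k<6. ?f k 0 / fact k * (2 * c) ^ k) + ?f 6 t / fact 6 * (2 * c) ^ 6"
    by blast
  \<comment> \<open>With the constant 1/2 the Taylor polynomial equals exactly 2, so the sign of the
    remainder decides.\<close>
  have "(\<Sum>k<6. ?f k 0 / fact k * (2 * c) ^ k) = 3 / 2"
    by (simp add: eval_nat_numeral sqrt3_square field_simps)
  moreover have "?f 6 t < 0"
  proof -
    \<comment> \<open>Since \<open>t / 2 < c\<close>, this cosine exceeds 1/2 and outweighs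
      \<open>1 / 2 * cos t\<close> even where \<open>cos t\<close> is -1.\<close>
    have "cos (pi / 3) < cos (t / 2)"
      using assms t by (intro cos_monotone_0_pi) auto
    then have C: "1 / 2 < cos (t / 2)" by (simp add: cos_60)
    moreover have "cos (t / 2) \<le> cos (t / 2) * cosh (sqrt 3 / 2 * t)"
      using C cosh_real_ge_1 mult_left_mono[of 1 _ "cos (t / 2)"] by simp
    moreover have "- 1 \<le> cos t" by simp
    ultimately have "0 < 1 / 2 * cos t + cos (t / 2) * cosh (sqrt 3 / 2 * t)" by linarith
    then show ?thesis unfolding jet_6 by (simp add: mult.commute)
  qed
  then have "?f 6 t / fact 6 * (2 * c) ^ 6 < 0"
    using assms by (intro mult_neg_pos divide_neg_pos zero_less_power) auto
  ultimately show ?thesis unfolding odd_char_eq_jet eq by linarith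
qed

text \<open>On this range tan t \<ge> sqrt 3, so in the derivative \<open>sin t * cosh z\<close>
  beats \<open>sqrt 3 * cos t * sinh z\<close>.\<close>

lemma odd_char_decreasing:
  assumes "pi / 3 \<le> x" "x < y" "y \<le> pi / 2"
  shows "odd_char (2 * real j * pi + y) < odd_char (2 * real j * pi + x)"
proof (rule DERIV_neg_imp_decreasing[of x y "\<lambda>t. odd_char (2 * real j * pi + t)"])
  fix t
  assume t: "x \<le> t" "t \<le> y"
  define z where "z = sqrt 3 * (2 * real j * pi + t)"
  have tpi: "pi / 3 \<le> t" "t \<le> pi / 2" using t assms by auto
  have z: "0 \<le> z"
    unfolding z_def using order_trans[OF _ tpi(1), of 0] by simp
  have C: "0 \<le> cos t" "cos t \<le> 1 / 2"
    using tpi pi_gt_zero cos_monotone_0_pi_le[of "pi / 3" t] cos_ge_zero[of t] by (simp_all add: cos_60)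
  have S: "sqrt 3 / 2 \<le> sin t"
    using tpi sin_monotone_2pi_le[of "pi / 3" t] by (simp add: sin_60)
  then have s0: "0 < sin t" by (smt (verit) real_sqrt_gt_zero divide_pos_pos)
  have "sqrt 3 * cos t \<le> sqrt 3 * (1 / 2)" using C by (intro mult_left_mono) auto
  then have "sqrt 3 * cos t \<le> sin t" using S by linarith
  then have "sqrt 3 * cos t * sinh z \<le> sin t * sinh z"
    using z by (intro mult_right_mono) auto
  also have "\<dots> < sin t * cosh z"
    using s0 sinh_less_cosh_real by (intro mult_strict_left_mono) auto
  finally have "sqrt 3 * cos t * sinh z < sin t * cosh z" .
  moreover have "0 \<le> sin t * cos t" using s0 C by simp
  ultimately have neg: "- sin t * (cosh z + cos t) + cos t * (sqrt 3 * sinh z - sin t) < 0"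
    by (simp add: algebra_simps)
  have "((\<lambda>t. odd_char (2 * real j * pi + t)) has_real_derivative
      - sin t * (cosh z + cos t) + cos t * (sqrt 3 * sinh z - sin t)) (at t)"
    unfolding odd_char_def cos_shift z_def
    by (rule derivative_eq_intros refl)+ (simp add: algebra_simps)
  then show "\<exists>y. ((\<lambda>t. odd_char (2 * real j * pi + t)) has_real_derivative y) (at t) \<and> y < 0"
    using neg by blast
qed fact

text \<open>Just left of a positive multiple of 2 pi both factors are nonnegative and
  increasing.\<close>

lemma odd_char_increasing:
  assumes "j \<ge> 1" "- pi / 2 \<le> x" "x < y" "y \<le> 0"
  shows "odd_char (2 * real j * pi + x) < odd_char (2 * real j * pi + y)"
proof -
  have C: "0 \<le> cos x" "cos x < cos y"
    using assms cos_ge_zero[of x] cos_monotone_minus_pi_0[of x y] pi_gt_zero by auto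
  have "1 * (2 * pi) \<le> real j * (2 * pi)" using assms by (intro mult_right_mono) auto
  then have "0 \<le> 2 * real j * pi + x" using assms pi_gt_zero by linarith
  then have H: "cosh (sqrt 3 * (2 * real j * pi + x)) < cosh (sqrt 3 * (2 * real j * pi + y))"
    using assms by (intro cosh_real_strict_mono) auto
  show ?thesis
    unfolding odd_char_def cos_shift using C H cosh_plus_cos_nonneg
    by (intro mult_strict_mono') (auto intro: add_strict_mono)
qed

lemma cos_nonpos: "pi / 2 \<le> \<bar>t\<bar> \<Longrightarrow> \<bar>t\<bar> \<le> pi \<Longrightarrow> cos t \<le> 0"
  using cos_monotone_0_pi_le[of "pi / 2" "\<bar>t\<bar>"] by simp

lemma odd_char_less_2:
  assumes "0 < c" "c \<le> pi"
  shows "odd_char c < 2"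
proof -
  consider "c \<le> pi / 3" | "pi / 3 < c" "c \<le> pi / 2" | "pi / 2 < c" by linarith
  then show ?thesis
  proof cases
    case 1
    then show ?thesis using odd_char_less_2_near_0 assms by simp
  next
    case 2
    then show ?thesis
      using odd_char_decreasing[of "pi / 3" c 0] odd_char_less_2_near_0[of "pi / 3"] by simp
  next
    case 3
    then show ?thesis using assms odd_char_nonpos[OF cos_nonpos[of c]] by simp
  qed
qed

lemma odd_char_gt_2:
  assumes "j \<ge> 1" "0 \<le> t" "t \<le> pi / 3"
  shows "odd_char (2 * real j * pi + t) > 2"
proof -
  define z where "z = sqrt 3 * (2 * real j * pi + t)"
  have "1 * (2 * pi) \<le> real j * (2 * pi)" using assms by (intro mult_right_mono) auto
  then have c: "2 * pi \<le> 2 * real j * pi + t" using assms by linarith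
  \<comment> \<open>From z > 9 and 2 cosh z > exp z \<ge> z + 1 follows cosh z > 4, enough once
    \<open>cos t\<close> is at least 1/2.\<close>
  have "sqrt 3 * 6 \<le> z"
    unfolding z_def using c pi_gt3 by (intro mult_left_mono) auto
  moreover have "sqrt 3 > (3/2::real)" by (rule real_less_rsqrt) (simp add: power2_eq_square)
  ultimately have "z > 9" by linarith
  then have H: "4 < cosh z"
    using exp_ge_add_one_self[of z] cosh_plus_sinh[of z] sinh_less_cosh_real[of z] by linarith
  have C: "1 / 2 \<le> cos t"
    using cos_monotone_0_pi_le[of t "pi / 3"] assms pi_gt_zero by (simp add: cos_60)
  have "2 < 1 / 2 * (cosh z + cos t)" using H C by simp
  also have "\<dots> \<le> cos t * (cosh z + cos t)"
    using C cosh_plus_cos_nonneg by (intro mult_right_mono) auto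
  finally show ?thesis unfolding odd_char_def cos_shift z_def .
qed

lemma continuous_on_odd_char: "continuous_on S odd_char"
  unfolding odd_char_def by (intro continuous_intros)

text \<open>In the first half of the interval the cosine is nonpositive, so a root lies in the
  second half, where the function increases from at most 0 to above 2.\<close>

lemma odd_char_root_left:
  assumes "j \<ge> 1"
  shows "\<exists>!c. (2 * real j - 1) * pi < c \<and> c < 2 * real j * pi \<and> odd_char c = 2"
proof (rule ex_ex1I)
  let ?z = "2 * real j * pi"
  have "odd_char (?z + (- pi / 2)) \<le> 0"
    by (rule odd_char_nonpos, unfold cos_shift, rule cos_nonpos) auto
  moreover have gt: "odd_char ?z > 2" using odd_char_gt_2[of j 0] assms by simp
  ultimately obtain c where c: "?z - pi / 2 \<le> c" "c \<le> ?z" "odd_char c = 2"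
    using IVT'[of odd_char "?z - pi / 2" 2 ?z] continuous_on_odd_char by auto
  have "c \<noteq> ?z" using c gt by auto
  moreover have "(2 * real j - 1) * pi < c" using c pi_gt_zero unfolding left_diff_distrib by linarith
  ultimately show "\<exists>c. (2 * real j - 1) * pi < c \<and> c < ?z \<and> odd_char c = 2"
    using c by (intro exI[of _ c]) auto
next
  let ?z = "2 * real j * pi"
  have loc: "- pi / 2 \<le> c - ?z \<and> c - ?z \<le> 0"
    if "(2 * real j - 1) * pi < c \<and> c < ?z \<and> odd_char c = 2" for c
  proof (rule ccontr)
    assume "\<not> ?thesis"
    then have "pi / 2 \<le> \<bar>c - ?z\<bar>" "\<bar>c - ?z\<bar> \<le> pi" using that by (auto simp: algebra_simps)
    then have "cos (c - ?z) \<le> 0" by (rule cos_nonpos)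
    then have "cos c \<le> 0" using cos_shift(1)[of j "c - ?z"] by simp
    then show False using that odd_char_nonpos[of c] by simp
  qed
  fix c d
  assume c: "(2 * real j - 1) * pi < c \<and> c < ?z \<and> odd_char c = 2"
    and d: "(2 * real j - 1) * pi < d \<and> d < ?z \<and> odd_char d = 2"
  then show "c = d"
    using odd_char_increasing[OF assms, of "c - ?z" "d - ?z"]
      odd_char_increasing[OF assms, of "d - ?z" "c - ?z"] loc[OF c] loc[OF d]
    by (cases c d rule: linorder_cases) auto
qed

text \<open>Up to pi/3 past the multiple of 2 pi the function exceeds 2, and from pi/2 on it is
  nonpositive; in between it decreases.\<close>

lemma odd_char_root_right:
  assumes "j \<ge> 1"
  shows "\<exists>!c. 2 * real j * pi < c \<and> c < (2 * real j + 1) * pi \<and> odd_char c = 2"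
proof (rule ex_ex1I)
  let ?z = "2 * real j * pi"
  have "odd_char (?z + pi / 2) \<le> 0"
    by (rule odd_char_nonpos, unfold cos_shift, rule cos_nonpos) auto
  moreover have gt: "odd_char ?z > 2" using odd_char_gt_2[of j 0] assms by simp
  ultimately obtain c where c: "?z \<le> c" "c \<le> ?z + pi / 2" "odd_char c = 2"
    using IVT2'[of odd_char "?z + pi / 2" 2 ?z] continuous_on_odd_char by auto
  have "c \<noteq> ?z" using c gt by auto
  moreover have "c < (2 * real j + 1) * pi" using c pi_gt_zero unfolding distrib_right by linarith
  ultimately show "\<exists>c. ?z < c \<and> c < (2 * real j + 1) * pi \<and> odd_char c = 2"
    using c by (intro exI[of _ c]) auto
next
  let ?z = "2 * real j * pi"
  have loc: "pi / 3 \<le> c - ?z \<and> c - ?z \<le> pi / 2"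
    if "?z < c \<and> c < (2 * real j + 1) * pi \<and> odd_char c = 2" for c
  proof -
    have "pi / 3 \<le> c - ?z"
      using odd_char_gt_2[OF assms, of "c - ?z"] that by force
    moreover have "c - ?z \<le> pi / 2"
    proof (rule ccontr)
      assume "\<not> ?thesis"
      then have "pi / 2 \<le> \<bar>c - ?z\<bar>" "\<bar>c - ?z\<bar> \<le> pi" using that by (auto simp: algebra_simps)
      then have "cos (c - ?z) \<le> 0" by (rule cos_nonpos)
      then have "cos c \<le> 0" using cos_shift(1)[of j "c - ?z"] by simp
      then show False using that odd_char_nonpos[of c] by simp
    qed
    ultimately show ?thesis by blast
  qed
  fix c d
  assume c: "?z < c \<and> c < (2 * real j + 1) * pi \<and> odd_char c = 2"
    and d: "?z < d \<and> d < (2 * real j + 1) * pi \<and> odd_char d = 2"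
  then show "c = d"
    using odd_char_decreasing[of "c - ?z" "d - ?z" j] odd_char_decreasing[of "d - ?z" "c - ?z" j]
      loc[OF c] loc[OF d]
    by (cases c d rule: linorder_cases) auto
qed

lemma odd_char_root:
  assumes "k \<ge> 1"
  shows "\<exists>!c. real k * pi < c \<and> c < (real k + 1) * pi \<and> odd_char c = 2"
proof (cases "even k")
  case True
  then obtain j where k: "k = 2 * j" by (elim evenE)
  with assms have "j \<ge> 1" by simp
  from odd_char_root_right[OF this] show ?thesis by (simp add: k)
next
  case False
  then obtain i where k: "k = 2 * i + 1" by (elim oddE)
  from odd_char_root_left[of "Suc i"] show ?thesis by (simp add: k algebra_simps)
qed

lemma odd_char_multiple_pi:
  assumes "k \<ge> 1"
  shows "odd_char (real k * pi) \<noteq> 2"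
proof (cases "even k")
  case True
  then obtain j where k: "k = 2 * j" by (elim evenE)
  with assms have "j \<ge> 1" by simp
  from odd_char_gt_2[OF this, of 0] show ?thesis by (simp add: k)
next
  case False
  then have "cos (real k * pi) \<le> 0" by simp
  then show ?thesis using odd_char_nonpos[of "real k * pi"] by auto
qed

text \<open>The description is meaningful only for \<open>k \<ge> 1\<close>: by
  \<open>odd_char_less_2\<close> no root lies between 0 and pi.\<close>

definition odd_root :: "nat \<Rightarrow> real" where
  "odd_root k = (THE c. real k * pi < c \<and> c < (real k + 1) * pi \<and> odd_char c = 2)"

lemma odd_root:
  assumes "k \<ge> 1"
  shows "real k * pi < odd_root k" "odd_root k < (real k + 1) * pi" "odd_char (odd_root k) = 2"
  using theI'[OF odd_char_root[OF assms]] unfolding odd_root_def by blast+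

lemma odd_char_roots:
  assumes "c > 0"
  shows "odd_char c = 2 \<longleftrightarrow> (\<exists>k\<ge>1. c = odd_root k)"
proof
  assume c: "odd_char c = 2"
  define k where "k = nat \<lfloor>c / pi\<rfloor>"
  have k: "real k \<le> c / pi" "c / pi < real k + 1"
    using assms unfolding k_def by simp_all
  then have k: "real k * pi \<le> c" "c < (real k + 1) * pi" by (simp_all add: field_simps)
  have "k \<noteq> 0" using odd_char_less_2[of c] c k assms by (intro notI) simp
  then have k1: "k \<ge> 1" by simp
  have "real k * pi \<noteq> c" using odd_char_multiple_pi[OF k1] c by auto
  then have "c = odd_root k"
    using k c odd_root[OF k1] odd_char_root[OF k1] by (metis order_le_imp_less_or_eq)
  then show "\<exists>k\<ge>1. c = odd_root k" using k1 by blast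
qed (auto simp: odd_root)

section \<open>The stated equation and the enumeration of the eigenvalues\<close>

lemma char_eq_iff:
  assumes "m > 0"
  shows "char_eq m \<longleftrightarrow> odd_char (m / 2) = 2"
proof -
  define c where "c = m / 2"
  have m: "m = 2 * c" by (simp add: c_def)
  define H where "H = cosh (sqrt 3 * c)"
  define C where "C = cos c"
  have "H > 1" using cosh_sqrt3_gt_1[of c] assms by (simp add: H_def c_def)
  moreover have "C \<le> 1" by (simp add: C_def)
  ultimately have HC: "H - C \<noteq> 0" by simp
  have "m * sqrt 3 = 2 * (sqrt 3 * c)" "m * sqrt 3 / 2 = sqrt 3 * c" by (simp_all add: m)
  then have cosh: "cosh (m * sqrt 3) = 2 * H ^ 2 - 1" "cosh (m * sqrt 3 / 2) = H"
    by (simp_all only: cosh_double_cosh H_def)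
  have cos: "cos m = 2 * C ^ 2 - 1" "cos (m / 2) = C"
    unfolding m cos_double_cos C_def by simp_all
  have "2 * H ^ 2 - 1 \<noteq> 0" using cosh_real_nonzero[of "m * sqrt 3"] unfolding cosh .
  then have "char_eq m \<longleftrightarrow> C * (2 * H ^ 2 - 1) = 4 * H + (C * (2 * C ^ 2 - 1) - 4 * C)"
    unfolding char_eq_def cosh cos times_divide_eq_left mult_1 add_divide_distrib[symmetric]
    by (simp only: eq_divide_eq simp_thms if_True)
  also have "\<dots> \<longleftrightarrow> 2 * (H - C) * (C * (H + C) - 2) = 0"
    by (simp add: algebra_simps power2_eq_square)
  also have "\<dots> \<longleftrightarrow> odd_char (m / 2) = 2"
    using HC by (simp add: odd_char_def H_def C_def c_def)
  finally show ?thesis .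
qed

lemma sixth_order_eigenvalue_iff_roots:
  "sixth_order_eigenvalue lam \<longleftrightarrow>
     (\<exists>m>0. lam = m ^ 6 \<and> (sin (m / 2) = 0 \<or> odd_char (m / 2) = 2))"
proof -
  have iff: "sixth_order_eigenvalue (m ^ 6) \<longleftrightarrow> sin (m / 2) = 0 \<or> odd_char (m / 2) = 2"
    if "m > 0" for m
  proof -
    have "cosh (sqrt 3 * (m / 2)) > 1" using that by (intro cosh_sqrt3_gt_1) simp
    then have "cosh (sqrt 3 * (m / 2)) - cos (m / 2) \<noteq> 0" using cos_le_one[of "m / 2"] by linarith
    then have "det (jet_matrix True (m / 2)) = 0 \<longleftrightarrow> sin (m / 2) = 0"
      unfolding det_jet_matrix_even by simp
    moreover have "det (jet_matrix False (m / 2)) = 0 \<longleftrightarrow> odd_char (m / 2) = 2"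
      unfolding det_jet_matrix_odd odd_char_def by auto
    ultimately show ?thesis unfolding eigenvalue_iff_det[OF that] ex_bool_eq by simp
  qed
  show ?thesis
  proof
    assume e: "sixth_order_eigenvalue lam"
    then have "lam > 0" by (rule eigenvalue_pos)
    then have "root 6 lam > 0" "lam = root 6 lam ^ 6" by simp_all
    then show "\<exists>m>0. lam = m ^ 6 \<and> (sin (m / 2) = 0 \<or> odd_char (m / 2) = 2)"
      using iff e by metis
  qed (use iff in blast)
qed

theorem theorem2p2:
  shows "\<exists>\<mu> :: nat \<Rightarrow> real.
    strict_mono_on {2..} \<mu>
    \<and> (\<forall>n\<ge>2. even n \<longrightarrow> \<mu> n = real n * pi)
    \<and> {\<mu> n | n. n \<ge> 3 \<and> odd n} = {m. m > 0 \<and> char_eq m}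
    \<and> {lam. sixth_order_eigenvalue lam} = {\<mu> n ^ 6 | n. n \<ge> 2}"
proof -
  \<comment> \<open>Roots are in \<open>c = m / 2\<close>, hence the factor 2. For n = 2k + 1 with k
    \<ge> 1 the value lies between 2k pi and (2k + 2) pi, the two neighbouring even values.\<close>
  define \<mu> where "\<mu> n = (if even n then real n * pi else 2 * odd_root (n div 2))" for n :: nat
  have step: "\<mu> n < \<mu> (Suc n)" if n: "n \<ge> 2" for n
  proof (cases "even n")
    case True
    then obtain k where k: "n = 2 * k" by (elim evenE)
    with n show ?thesis using odd_root(1)[of k] by (simp add: \<mu>_def)
  next
    case False
    then obtain k where k: "n = 2 * k + 1" by (elim oddE)
    with n show ?thesis using odd_root(2)[of k] by (simp add: \<mu>_def algebra_simps)
  qed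
  \<comment> \<open>The shift by 2 discards index 1, whose value would come from the unspecified
    \<open>odd_root 0\<close>.\<close>
  have "strict_mono (\<lambda>k. \<mu> (k + 2))" unfolding strict_mono_Suc_iff using step by simp
  then have mono: "strict_mono_on {2..} \<mu>"
  proof (intro strict_mono_onI)
    fix i j :: nat
    assume m: "strict_mono (\<lambda>k. \<mu> (k + 2))" and ij: "i \<in> {2..}" "j \<in> {2..}" "i < j"
    then have "i - 2 < j - 2" "i - 2 + 2 = i" "j - 2 + 2 = j" by auto
    then show "\<mu> i < \<mu> j" using strict_monoD[OF m, of "i - 2" "j - 2"] by simp
  qed
  have pos: "\<mu> n > 0" if "n \<ge> 2" for n
  proof -
    have "\<mu> 2 \<le> \<mu> n" using mono that by (simp add: strict_mono_on_leD)
    moreover have "\<mu> 2 = 2 * pi" by (simp add: \<mu>_def)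
    ultimately show ?thesis using pi_gt_zero by linarith
  qed
  have odds: "odd_char (m / 2) = 2 \<longleftrightarrow> (\<exists>n\<ge>3. odd n \<and> m = \<mu> n)" if "m > 0" for m
  proof -
    have "odd_char (m / 2) = 2 \<longleftrightarrow> (\<exists>k\<ge>1. m / 2 = odd_root k)"
      using odd_char_roots that by simp
    also have "\<dots> \<longleftrightarrow> (\<exists>k\<ge>1. m = \<mu> (2 * k + 1))" by (auto simp: \<mu>_def)
    also have "\<dots> \<longleftrightarrow> (\<exists>n\<ge>3. odd n \<and> m = \<mu> n)"
    proof
      assume "\<exists>k\<ge>1. m = \<mu> (2 * k + 1)"
      then obtain k where "k \<ge> 1" "m = \<mu> (2 * k + 1)" by blast
      then show "\<exists>n\<ge>3. odd n \<and> m = \<mu> n" by (intro exI[of _ "2 * k + 1"]) simp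
    next
      assume "\<exists>n\<ge>3. odd n \<and> m = \<mu> n"
      then obtain n where "n \<ge> 3" "odd n" "m = \<mu> n" by blast
      then show "\<exists>k\<ge>1. m = \<mu> (2 * k + 1)" by (intro exI[of _ "n div 2"]) auto
    qed
    finally show ?thesis .
  qed
  have evens: "sin (m / 2) = 0 \<longleftrightarrow> (\<exists>n\<ge>2. even n \<and> m = \<mu> n)" if m: "m > 0" for m
  proof
    assume "sin (m / 2) = 0"
    then obtain n where n: "even n" "m / 2 = real n * (pi / 2)"
      using sin_zero_lemma[of "m / 2"] m by auto
    with m have "n \<noteq> 0" by (intro notI) simp
    with n have "n \<ge> 2" by (auto elim!: evenE)
    with n show "\<exists>n\<ge>2. even n \<and> m = \<mu> n" by (intro exI[of _ n]) (simp add: \<mu>_def)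
  next
    assume "\<exists>n\<ge>2. even n \<and> m = \<mu> n"
    then obtain n where "even n" "m = real n * pi" by (auto simp: \<mu>_def)
    then show "sin (m / 2) = 0" by (auto elim!: evenE)
  qed
  have "{\<mu> n | n. n \<ge> 3 \<and> odd n} = {m. m > 0 \<and> char_eq m}"
  proof (intro equalityI subsetI)
    fix m assume "m \<in> {\<mu> n | n. n \<ge> 3 \<and> odd n}"
    then obtain n where n: "n \<ge> 3" "odd n" "m = \<mu> n" by blast
    then have "m > 0" using pos by simp
    then show "m \<in> {m. m > 0 \<and> char_eq m}" using n odds char_eq_iff by blast
  next
    fix m assume "m \<in> {m. m > 0 \<and> char_eq m}"
    then show "m \<in> {\<mu> n | n. n \<ge> 3 \<and> odd n}" using odds char_eq_iff by blast
  qed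
  moreover have "{lam. sixth_order_eigenvalue lam} = {\<mu> n ^ 6 | n. n \<ge> 2}"
  proof (intro equalityI subsetI)
    fix lam assume "lam \<in> {lam. sixth_order_eigenvalue lam}"
    then obtain m where m: "m > 0" "lam = m ^ 6" "sin (m / 2) = 0 \<or> odd_char (m / 2) = 2"
      unfolding sixth_order_eigenvalue_iff_roots by blast
    have "n \<ge> 2" if "n \<ge> 3" for n :: nat using that by simp
    then obtain n where "n \<ge> 2" "m = \<mu> n"
      using m(3) unfolding evens[OF m(1)] odds[OF m(1)] by blast
    then show "lam \<in> {\<mu> n ^ 6 | n. n \<ge> 2}" using m by blast
  next
    fix lam assume "lam \<in> {\<mu> n ^ 6 | n. n \<ge> 2}"
    then obtain n where n: "n \<ge> 2" "lam = \<mu> n ^ 6" by blast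
    have "n \<ge> 3" if "odd n" using n that by (cases "n = 2") auto
    then have "sin (\<mu> n / 2) = 0 \<or> odd_char (\<mu> n / 2) = 2"
      using evens[OF pos[OF n(1)]] odds[OF pos[OF n(1)]] n by blast
    then show "lam \<in> {lam. sixth_order_eigenvalue lam}"
      unfolding sixth_order_eigenvalue_iff_roots using n pos by blast
  qed
  moreover have "\<forall>n\<ge>2. even n \<longrightarrow> \<mu> n = real n * pi" by (simp add: \<mu>_def)
  ultimately show ?thesis using mono by blast
qed

end
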